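(* Let $V$ be a euclidean space of dimension $n\ge 2$, let $c(t)$ be a regular curve in $V$ and let $\kappa_1(t),\dots,\kappa_{n-1}(t)$ be its curvatures. Let $L:V\to V$ be an invertible linear mapping, let $\lambda\in V$ be arbitrary, and set $\tilde c(t)=Lc(t)+\lambda$. Denote by $\tilde\kappa_1(t),\dots,\tilde\kappa_{n-1}(t)$ the curvatures of $\tilde c$. Let $\|\cdot\|$ denote the operator norm. Then for $1\le r\le n-2$, $$\|L^{-1}\|^{-2r}\,\|L\|^{-2r-1}\,\kappa_r\ \le\ \tilde\kappa_r\ \le\ \|L\|^{2r}\,\|L^{-1}\|^{2r+1}\,\kappa_r ,$$ and $$\|L^{-1}\|^{-2}\,\|L\|^{-3}\,|\kappa_{n-1}|\ \le\ |\tilde\kappa_{n-1}|\ \le\ \|L\|^{2}\,\|L^{-1}\|^{3}\,|\kappa_{n-1}| .$$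
   Context: A euclidean space is a finite-dimensional, oriented, real vector space $V$ with a positive definite scalar product $\langle\cdot,\cdot\rangle$. A regular curve in $V$ ($\dim V=n$) is a map $c:[a,b]\to V$, $a<b$, which is differentiable as many times as needed and such that $c'(t),\dots,c^{(n-1)}(t)$ are linearly independent for every $t\in[a,b]$. Frenet-Serret frame $e(t)=(e_1(t),\dots,e_n(t))$: $e_1,\dots,e_{n-1}$ is the Gram-Schmidt orthonormalization of $c',\dots,c^{(n-1)}$ (so $e_i$ is a linear combination of $c',\dots,c^{(i)}$ with positive coefficient at $c^{(i)}$), and $e_n$ is the unique vector making $e_1,\dots,e_n$ a positive orthonormal basis. The curvatures $\kappa_1,\dots,\kappa_{n-1}$ are the functions determined by the Frenet-Serret equation $e_i'=\|c'\|\,(-\kappa_{i-1}e_{i-1}+\kappa_i e_{i+1})$, $1\le i\le n$ (terms involving $e_0$ or $e_{n+1}$ are absent); equivalently $\kappa_r=\langle e_r',e_{r+1}\rangle/\|c'\|$. *)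

theory Defs
  imports "HOL-Analysis.Analysis" "Jordan_Normal_Form.Determinant"
begin

text \<open>Ordered families of vectors are lists. Since independence of a set does not see repeated
  vectors, distinctness is required separately.\<close>

definition lin_indep_list :: "'a::real_vector list \<Rightarrow> bool" where
  "lin_indep_list xs \<longleftrightarrow> distinct xs \<and> independent (set xs)"

definition ordered_basis :: "'a::euclidean_space list \<Rightarrow> bool" where
  "ordered_basis xs \<longleftrightarrow> length xs = DIM('a) \<and> lin_indep_list xs"

definition orthonormal_list :: "'a::real_inner list \<Rightarrow> bool" where
  "orthonormal_list xs \<longleftrightarrow>
     (\<forall>i<length xs. \<forall>j<length xs. xs ! i \<bullet> xs ! j = (if i = j then 1 else 0))"

text \<open>Two ordered bases have the same orientation if the matrix of the change of basis has positive
  determinant; an orientation is an equivalence class. The type class fixes the scalar product but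
  no orientation, so the latter is carried as a separate datum \<open>Or\<close>, whose members are the positive
  bases.\<close>

definition same_orientation :: "('a::euclidean_space list \<times> 'a list) set" where
  "same_orientation = {(xs, ys). ordered_basis xs \<and> ordered_basis ys \<and>
     (\<exists>M \<in> carrier_mat DIM('a) DIM('a). Determinant.det M > 0 \<and>
        (\<forall>j<DIM('a). ys ! j = (\<Sum>i<DIM('a). (M $$ (i, j)) *\<^sub>R (xs ! i))))}"

definition orientation :: "'a::euclidean_space list set \<Rightarrow> bool" where
  "orientation Or \<longleftrightarrow> Or \<in> Collect ordered_basis // same_orientation"

text \<open>The \<open>k\<close>-th derivative of a curve on a compact interval, one-sided at the end points.\<close>

definition nth_derivative ::
    "real \<Rightarrow> real \<Rightarrow> (real \<Rightarrow> 'a) \<Rightarrow> nat \<Rightarrow> real \<Rightarrow> 'a::real_normed_vector" where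
  "nth_derivative a b c k =
     ((\<lambda>f t. vector_derivative f (at t within {a..b})) ^^ k) c"

text \<open>Differentiability of order \<open>n = DIM('a)\<close> is what is needed for all curvatures to
  be defined; no continuity of the last derivative is required.\<close>

definition regular_curve :: "real \<Rightarrow> real \<Rightarrow> (real \<Rightarrow> 'a::euclidean_space) \<Rightarrow> bool" where
  "regular_curve a b c \<longleftrightarrow> a < b \<and>
     (\<forall>k<DIM('a). nth_derivative a b c k differentiable_on {a..b}) \<and>
     (\<forall>t\<in>{a..b}. lin_indep_list (map (\<lambda>k. nth_derivative a b c k t) [1..<DIM('a)]))"

text \<open>Gram-Schmidt orthonormalization of \<open>v 1, v 2, \<dots>\<close>; note that \<open>sgn w = w /\<^sub>R norm w\<close>.\<close>

fun gram_schmidt :: "(nat \<Rightarrow> 'a) \<Rightarrow> nat \<Rightarrow> 'a::real_inner" where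
  "gram_schmidt v i =
     sgn (v i - (\<Sum>j\<in>{1..<i}. (v i \<bullet> gram_schmidt v j) *\<^sub>R gram_schmidt v j))"

declare gram_schmidt.simps [simp del]

text \<open>The frame vectors \<open>e\<^sub>1, \<dots>, e\<^sub>n\<close> are indexed from 1; other indices are irrelevant.\<close>

definition frenet_frame ::
    "'a list set \<Rightarrow> real \<Rightarrow> real \<Rightarrow> (real \<Rightarrow> 'a) \<Rightarrow> nat \<Rightarrow> real \<Rightarrow> 'a::euclidean_space" where
  "frenet_frame Or a b c i t =
     (let e = gram_schmidt (\<lambda>k. nth_derivative a b c k t) in
      if i < DIM('a) then e i
      else (THE v. let es = map e [1..<DIM('a)] @ [v] in es \<in> Or \<and> orthonormal_list es))"

definition curvature ::
    "'a::euclidean_space list set \<Rightarrow> real \<Rightarrow> real \<Rightarrow> (real \<Rightarrow> 'a) \<Rightarrow> nat \<Rightarrow> real \<Rightarrow> real" where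
  "curvature Or a b c r t =
     (vector_derivative (frenet_frame Or a b c r) (at t within {a..b})
        \<bullet> frenet_frame Or a b c (Suc r) t)
     / norm (nth_derivative a b c 1 t)"

end

theory Submission
  imports Defs
begin

text \<open>Let \<open>g\<^sub>i\<close> be the distance of \<open>c\<^sup>(\<^sup>i\<^sup>)\<close> from the span of \<open>c', \<dots>, c\<^sup>(\<^sup>i\<^sup>-\<^sup>1\<^sup>)\<close>, i.e. the length of the
  \<open>i\<close>-th vector of the Gram-Schmidt process before normalization. Differentiating
  \<open>e\<^sub>r\<close> gives \<open>\<bar>\<kappa>\<^sub>r\<bar> = g\<^sub>r\<^sub>+\<^sub>1 / (g\<^sub>r g\<^sub>1)\<close>, where \<open>\<kappa>\<^sub>r \<ge> 0\<close> for \<open>r \<le> n - 2\<close>. A linear map \<open>L\<close> carries spans to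
  spans and hence enlarges each of these distances at most by the factor \<open>\<parallel>L\<parallel>\<close>; the inverse of
  \<open>L\<close> bounds them from below. So \<open>\<bar>\<kappa>\<^sub>r\<bar>\<close> grows at most by \<open>\<parallel>L\<parallel> \<parallel>L\<^sup>-\<^sup>1\<parallel>\<^sup>2\<close>, which is at most
  \<open>\<parallel>L\<parallel>\<^sup>2\<^sup>m \<parallel>L\<^sup>-\<^sup>1\<parallel>\<^sup>2\<^sup>m\<^sup>+\<^sup>1\<close> for every \<open>m \<ge> 1\<close> because \<open>\<parallel>L\<parallel> \<parallel>L\<^sup>-\<^sup>1\<parallel> \<ge> 1\<close>.\<close>

no_notation Matrix.scalar_prod (infix "\<bullet>" 70)
hide_const (open) Matrix.orthogonal
hide_fact (open) Matrix.orthogonal_def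
declare One_nat_def [simp del]

section \<open>Gram-Schmidt residuals\<close>

text \<open>Normalization by \<open>sgn\<close> discards the length of this vector, and that length
  is what the curvatures are made of.\<close>

definition gs_residual :: "(nat \<Rightarrow> 'a::real_inner) \<Rightarrow> nat \<Rightarrow> 'a" where
  "gs_residual v i = v i - (\<Sum>j\<in>{1..<i}. (v i \<bullet> gram_schmidt v j) *\<^sub>R gram_schmidt v j)"

lemma gram_schmidt_eq: "gram_schmidt v i = sgn (gs_residual v i)"
  unfolding gs_residual_def by (rule gram_schmidt.simps)

text \<open>Strong induction: once the earlier vectors are known to be pairwise orthogonal, pairing
  the subtracted sum with the \<open>k\<close>-th one leaves a single term, which cancels against
  that of \<open>v i\<close>.\<close>

lemma gs_residual_orthogonal:
  assumes "1 \<le> k" "k < i"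
  shows "gs_residual v i \<bullet> gram_schmidt v k = 0"
  using assms
proof (induction i arbitrary: k rule: less_induct)
  case (less i)
  \<comment> \<open>Both indices lie below \<open>i\<close>, so the induction hypothesis applies to
    the residual at the larger of the two.\<close>
  have orth: "gram_schmidt v j \<bullet> gram_schmidt v k = 0" if "j \<in> {1..<i}" "j \<noteq> k" for j
  proof (cases "k < j")
    case True
    then show ?thesis
      using less that by (simp add: gram_schmidt_eq[of v j] sgn_div_norm)
  next
    case False
    then have "gs_residual v k \<bullet> gram_schmidt v j = 0"
      using less that by simp
    then show ?thesis
      by (simp add: gram_schmidt_eq[of v k] sgn_div_norm inner_commute)
  qed
  have "(\<Sum>j\<in>{1..<i}. (v i \<bullet> gram_schmidt v j) *\<^sub>R gram_schmidt v j) \<bullet> gram_schmidt v k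
      = (\<Sum>j\<in>{1..<i}. if j = k then (v i \<bullet> gram_schmidt v k) * (gram_schmidt v k \<bullet> gram_schmidt v k) else 0)"
    unfolding inner_sum_left using orth by (intro sum.cong) auto
  also have "\<dots> = (v i \<bullet> gram_schmidt v k) * (gram_schmidt v k \<bullet> gram_schmidt v k)"
    using less.prems by simp
  also have "\<dots> = v i \<bullet> gram_schmidt v k"
  \<comment> \<open>Since \<open>sgn 0 = 0\<close>, \<open>gram_schmidt v k\<close> is either a unit
    vector or zero; in the second case both sides vanish.\<close>
  proof (cases "gs_residual v k = 0")
    case False
    then have "gram_schmidt v k \<bullet> gram_schmidt v k = 1"
      by (simp add: gram_schmidt_eq norm_sgn dot_square_norm)
    then show ?thesis by simp
  qed (simp add: gram_schmidt_eq)
  finally show ?case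
    by (simp add: gs_residual_def inner_diff_left)
qed

lemma gram_schmidt_orthogonal:
  assumes "1 \<le> i" "1 \<le> j" "i \<noteq> j"
  shows "gram_schmidt v i \<bullet> gram_schmidt v j = 0"
proof (cases "j < i")
  case True
  then show ?thesis
    using assms gs_residual_orthogonal[of j i v] by (simp add: gram_schmidt_eq[of v i] sgn_div_norm)
next
  case False
  then show ?thesis
    using assms gs_residual_orthogonal[of i j v]
    by (simp add: gram_schmidt_eq[of v j] sgn_div_norm inner_commute)
qed

lemma gram_schmidt_in_span:
  assumes "1 \<le> i" "i < k"
  shows "gram_schmidt v i \<in> span (v ` {1..<k})"
  using assms
proof (induction i rule: less_induct)
  case (less i)
  then have "gs_residual v i \<in> span (v ` {1..<k})"
    unfolding gs_residual_def
    by (intro span_diff span_sum span_scale less.IH) (auto intro: span_base)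
  then show ?case
    by (simp add: gram_schmidt_eq sgn_div_norm span_scale)
qed

lemma gs_residual_diff_in_span: "v i - gs_residual v i \<in> span (v ` {1..<i})"
  unfolding gs_residual_def
  by (auto intro!: span_sum span_scale gram_schmidt_in_span)

lemma norm_residual_scaleR: "norm (gs_residual v i) *\<^sub>R gram_schmidt v i = gs_residual v i"
  by (cases "gs_residual v i = 0") (auto simp: gram_schmidt_eq sgn_div_norm)

text \<open>The Gram-Schmidt recursion is triangular: solved for \<open>v i\<close>, it gives a
  combination of the orthonormalized vectors up to index \<open>i\<close>.\<close>

lemma span_subset_span_gram_schmidt:
  "span (v ` {1..<k}) \<subseteq> span (gram_schmidt v ` {1..<k})"
proof (rule span_minimal)
  show "v ` {1..<k} \<subseteq> span (gram_schmidt v ` {1..<k})"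
  proof
    fix x assume "x \<in> v ` {1..<k}"
    then obtain i where i: "i \<in> {1..<k}" "x = v i" by auto
    have "v i = norm (gs_residual v i) *\<^sub>R gram_schmidt v i
        + (\<Sum>j\<in>{1..<i}. (v i \<bullet> gram_schmidt v j) *\<^sub>R gram_schmidt v j)"
      unfolding norm_residual_scaleR by (simp add: gs_residual_def)
    also have "\<dots> \<in> span (gram_schmidt v ` {1..<k})"
      using i by (intro span_add span_sum span_scale span_base) auto
    finally show "x \<in> span (gram_schmidt v ` {1..<k})" using i by simp
  qed
qed simp

text \<open>Serves both the residuals and the last Frenet vector, whose orthogonality is known only
  against the orthonormalized vectors.\<close>

lemma orthogonal_gram_schmidt_imp_orthogonal_span:
  assumes "\<And>i. i \<in> {1..<k} \<Longrightarrow> x \<bullet> gram_schmidt v i = 0" "y \<in> span (v ` {1..<k})"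
  shows "x \<bullet> y = 0"
proof -
  have "y \<in> span (gram_schmidt v ` {1..<k})"
    using assms(2) span_subset_span_gram_schmidt by blast
  then have "orthogonal x y"
    by (rule orthogonal_to_span) (use assms(1) in \<open>auto simp: orthogonal_def\<close>)
  then show ?thesis by (simp add: orthogonal_def)
qed

lemma gs_residual_orthogonal_span:
  "y \<in> span (v ` {1..<i}) \<Longrightarrow> gs_residual v i \<bullet> y = 0"
  by (rule orthogonal_gram_schmidt_imp_orthogonal_span) (auto intro: gs_residual_orthogonal)

text \<open>Pythagoras: \<open>v i - y\<close> is the sum of the residual and a vector of the span,
  and these two are orthogonal. So the norm of the residual is the distance of \<open>v i\<close>
  from the span.\<close>

lemma norm_gs_residual_le:
  assumes "y \<in> span (v ` {1..<i})"
  shows "norm (gs_residual v i) \<le> norm (v i - y)"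
proof -
  have "v i - gs_residual v i - y \<in> span (v ` {1..<i})"
    by (intro span_diff gs_residual_diff_in_span assms)
  then have "orthogonal (gs_residual v i) (v i - gs_residual v i - y)"
    unfolding orthogonal_def by (rule gs_residual_orthogonal_span)
  from norm_add_Pythagorean[OF this]
  have "(norm (gs_residual v i))\<^sup>2 \<le> (norm (v i - y))\<^sup>2"
    by (simp add: algebra_simps)
  then show ?thesis by (rule power2_le_imp_le) simp
qed

text \<open>\<open>L\<close> maps the point of the old span nearest to \<open>v i\<close> into the
  new span. Its distance from \<open>L (v i)\<close> is the norm of the image of the old residual,
  which bounds the new distance.\<close>

lemma norm_gs_residual_image_le:
  assumes "bounded_linear L"
  shows "norm (gs_residual (\<lambda>k. L (v k)) i) \<le> onorm L * norm (gs_residual v i)"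
proof -
  interpret L: bounded_linear L by fact
  have "L (v i - gs_residual v i) \<in> L ` span (v ` {1..<i})"
    by (intro imageI gs_residual_diff_in_span)
  then have "L (v i - gs_residual v i) \<in> span ((\<lambda>k. L (v k)) ` {1..<i})"
    by (simp only: linear_span_image[OF L.linear_axioms, symmetric] image_image)
  then have "norm (gs_residual (\<lambda>k. L (v k)) i) \<le> norm (L (v i) - L (v i - gs_residual v i))"
    by (rule norm_gs_residual_le)
  also have "\<dots> = norm (L (gs_residual v i))" by (simp add: L.diff)
  also have "\<dots> \<le> onorm L * norm (gs_residual v i)" by (rule onorm[OF assms])
  finally show ?thesis .
qed

text \<open>The residual is orthogonal to its difference from \<open>v i\<close>, so
  \<open>v i\<close> may be replaced by the residual. The sign obtained here makes the lower
  curvatures nonnegative.\<close>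

lemma gs_residual_inner_gram_schmidt: "v i \<bullet> gram_schmidt v i = norm (gs_residual v i)"
proof -
  have "gs_residual v i \<bullet> (v i - gs_residual v i) = 0"
    by (rule gs_residual_orthogonal_span[OF gs_residual_diff_in_span])
  then have "v i \<bullet> gs_residual v i = (norm (gs_residual v i))\<^sup>2"
    by (simp add: inner_diff_right inner_commute dot_square_norm)
  then show ?thesis
    by (cases "gs_residual v i = 0") (simp_all add: gram_schmidt_eq sgn_div_norm power2_eq_square)
qed

section \<open>Differentiating the orthonormalized vectors\<close>

text \<open>In the product rule for \<open>f / norm f\<close>, differentiating the scalar factor
  yields only a multiple of \<open>f t\<close>. The coefficient stays unspecified because such a
  multiple later disappears in a span.\<close>

lemma has_vector_derivative_sgn:
  fixes f :: "real \<Rightarrow> 'a::real_inner"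
  assumes f: "(f has_vector_derivative f') (at t within S)" and nz: "f t \<noteq> 0"
  obtains k where
    "((\<lambda>x. sgn (f x)) has_vector_derivative (f' /\<^sub>R norm (f t) + k *\<^sub>R f t)) (at t within S)"
proof -
  have d: "(f has_derivative (\<lambda>x. x *\<^sub>R f')) (at t within S)"
    using f by (simp add: has_vector_derivative_def)
  have "((\<lambda>x. norm (f x)) has_derivative (\<lambda>h. (h *\<^sub>R f') \<bullet> sgn (f t))) (at t within S)"
    by (rule has_derivative_compose[OF d has_derivative_norm[OF nz]])
  then have n: "((\<lambda>x. norm (f x)) has_real_derivative (f' \<bullet> sgn (f t))) (at t within S)"
    by (simp add: has_field_derivative_def mult.commute[of _ "_ \<bullet> _"] mult_commute_abs)
  have i: "((\<lambda>x. inverse (norm (f x))) has_real_derivative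
       - (inverse (norm (f t)) * (f' \<bullet> sgn (f t)) * inverse (norm (f t)))) (at t within S)"
    by (rule DERIV_inverse'[OF n]) (use nz in simp)
  have "((\<lambda>x. inverse (norm (f x)) *\<^sub>R f x) has_vector_derivative
      (inverse (norm (f t)) *\<^sub>R f'
        + (- (inverse (norm (f t)) * (f' \<bullet> sgn (f t)) * inverse (norm (f t)))) *\<^sub>R f t)) (at t within S)"
    by (rule has_vector_derivative_scaleR[OF i f])
  then show ?thesis
    by (intro that[of "- (inverse (norm (f t)) * (f' \<bullet> sgn (f t)) * inverse (norm (f t)))"])
      (simp add: sgn_div_norm[abs_def])
qed

text \<open>The coefficient of \<open>v\<^sub>i\<^sub>+\<^sub>1\<close> is all that matters of \<open>e\<^sub>i'\<close>, since \<open>e\<^sub>i\<^sub>+\<^sub>1\<close> is orthogonal to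
  \<open>v\<^sub>1, \<dots>, v\<^sub>i\<close>.\<close>

lemma gram_schmidt_has_vector_derivative:
  fixes v :: "nat \<Rightarrow> real \<Rightarrow> 'a::real_inner"
  assumes der: "\<And>k. 1 \<le> k \<Longrightarrow> k \<le> i \<Longrightarrow> (v k has_vector_derivative v (Suc k) t) (at t within S)"
    and nz: "\<And>k. 1 \<le> k \<Longrightarrow> k \<le> i \<Longrightarrow> gs_residual (\<lambda>k. v k t) k \<noteq> 0"
    and "1 \<le> i"
  shows "\<exists>d. ((\<lambda>x. gram_schmidt (\<lambda>k. v k x) i) has_vector_derivative d) (at t within S) \<and>
    d - v (Suc i) t /\<^sub>R norm (gs_residual (\<lambda>k. v k t) i) \<in> span ((\<lambda>k. v k t) ` {1..<Suc i})"
  using assms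
proof (induction i rule: less_induct)
  case (less i)
  let ?V = "\<lambda>k. span ((\<lambda>j. v j t) ` {1..<k})"
  let ?e = "\<lambda>j x. gram_schmidt (\<lambda>k. v k x) j"
  have "\<forall>j\<in>{1..<i}. \<exists>d. (?e j has_vector_derivative d) (at t within S) \<and>
     d - v (Suc j) t /\<^sub>R norm (gs_residual (\<lambda>k. v k t) j) \<in> ?V (Suc j)"
    using less by auto
  then obtain d where d: "\<And>j. j \<in> {1..<i} \<Longrightarrow> (?e j has_vector_derivative d j) (at t within S)"
    and ds: "\<And>j. j \<in> {1..<i} \<Longrightarrow>
      d j - v (Suc j) t /\<^sub>R norm (gs_residual (\<lambda>k. v k t) j) \<in> ?V (Suc j)"
    by metis
  \<comment> \<open>By induction \<open>d j\<close> is a multiple of \<open>v (Suc j) t\<close> plus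
    a vector in the span of \<open>v 1 t, ..., v j t\<close>; as \<open>j < i\<close>, all of these
    have index at most \<open>i\<close>.\<close>
  have d_span: "d j \<in> ?V (Suc i)" if "j \<in> {1..<i}" for j
  proof -
    have "d j - v (Suc j) t /\<^sub>R norm (gs_residual (\<lambda>k. v k t) j) \<in> ?V (Suc i)"
      using ds[OF that] that span_mono[of "(\<lambda>j. v j t) ` {1..<Suc j}" "(\<lambda>j. v j t) ` {1..<Suc i}"]
      by fastforce
    moreover have "v (Suc j) t /\<^sub>R norm (gs_residual (\<lambda>k. v k t) j) \<in> ?V (Suc i)"
      using that by (intro span_scale span_base) auto
    ultimately show ?thesis
      using span_add by fastforce
  qed
  have e_span: "?e j t \<in> ?V (Suc i)" if "j \<in> {1..<i}" for j
    using that by (intro gram_schmidt_in_span) auto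
  \<comment> \<open>By the product rule, \<open>q\<close> is the derivative of the sum subtracted
    from \<open>v i\<close> in its residual.\<close>
  define q where "q = (\<Sum>j\<in>{1..<i}. (v i t \<bullet> ?e j t) *\<^sub>R d j
     + (v i t \<bullet> d j + v (Suc i) t \<bullet> ?e j t) *\<^sub>R ?e j t)"
  have vi: "(v i has_vector_derivative v (Suc i) t) (at t within S)"
    using less.prems by simp
  have q_span: "q \<in> ?V (Suc i)"
    unfolding q_def by (intro span_sum span_add span_scale d_span e_span)
  have summand: "((\<lambda>x. (v i x \<bullet> ?e j x) *\<^sub>R ?e j x) has_vector_derivative
      (v i t \<bullet> ?e j t) *\<^sub>R d j + (v i t \<bullet> d j + v (Suc i) t \<bullet> ?e j t) *\<^sub>R ?e j t) (at t within S)"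
    if "j \<in> {1..<i}" for j
  proof -
    have "((\<lambda>x. v i x \<bullet> ?e j x) has_vector_derivative (v i t \<bullet> d j + v (Suc i) t \<bullet> ?e j t)) (at t within S)"
      by (rule bounded_bilinear.has_vector_derivative[OF bounded_bilinear_inner vi d[OF that]])
    then show ?thesis
      by (intro has_vector_derivative_scaleR d that)
         (simp add: has_real_derivative_iff_has_vector_derivative)
  qed
  have "((\<lambda>x. gs_residual (\<lambda>k. v k x) i) has_vector_derivative (v (Suc i) t - q)) (at t within S)"
    unfolding gs_residual_def q_def
    by (intro has_vector_derivative_diff vi has_vector_derivative_sum summand)
  from has_vector_derivative_sgn[OF this] obtain k where k:
    "((\<lambda>x. sgn (gs_residual (\<lambda>k. v k x) i)) has_vector_derivative
      ((v (Suc i) t - q) /\<^sub>R norm (gs_residual (\<lambda>k. v k t) i) + k *\<^sub>R gs_residual (\<lambda>k. v k t) i)) (at t within S)"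
    using less.prems by auto
  have "gs_residual (\<lambda>k. v k t) i = norm (gs_residual (\<lambda>k. v k t) i) *\<^sub>R ?e i t"
    by (simp add: norm_residual_scaleR)
  also have "\<dots> \<in> ?V (Suc i)"
    using less.prems by (intro span_scale gram_schmidt_in_span) auto
  finally have r_span: "gs_residual (\<lambda>k. v k t) i \<in> ?V (Suc i)" .
  have "(v (Suc i) t - q) /\<^sub>R norm (gs_residual (\<lambda>k. v k t) i) + k *\<^sub>R gs_residual (\<lambda>k. v k t) i
     - v (Suc i) t /\<^sub>R norm (gs_residual (\<lambda>k. v k t) i)
     = k *\<^sub>R gs_residual (\<lambda>k. v k t) i - q /\<^sub>R norm (gs_residual (\<lambda>k. v k t) i)"
    by (simp add: scaleR_diff_right)
  also have "\<dots> \<in> ?V (Suc i)"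
    by (intro span_diff span_scale r_span q_span)
  finally show ?case
    using k unfolding gram_schmidt_eq by blast
qed

section \<open>Positive completion of an orthonormal family\<close>

text \<open>An explicit witness for the matrix in \<open>same_orientation\<close>: column
  \<open>j\<close> holds the coordinates of \<open>ys ! j\<close> when \<open>xs\<close> is a
  basis.\<close>

definition coordinate_mat :: "'a::euclidean_space list \<Rightarrow> 'a list \<Rightarrow> real mat" where
  "coordinate_mat xs ys =
     mat DIM('a) DIM('a) (\<lambda>(i, j). representation (set xs) (ys ! j) (xs ! i))"

lemma coordinate_mat_carrier [simp]:
  "coordinate_mat (xs :: 'a::euclidean_space list) ys \<in> carrier_mat DIM('a) DIM('a)"
  by (simp add: coordinate_mat_def)

lemma ordered_basis_span:
  assumes "ordered_basis (xs :: 'a::euclidean_space list)"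
  shows "span (set xs) = UNIV"
  using assms unfolding ordered_basis_def lin_indep_list_def
  by (metis card_eq_dim distinct_card dim_UNIV finite_set independent_imp_finite order_refl subset_UNIV top.extremum_uniqueI)

lemma sum_set_conv_nth:
  assumes "distinct xs"
  shows "sum f (set xs) = (\<Sum>i<length xs. f (xs ! i))"
  by (rule sum.reindex_bij_betw[OF bij_betw_nth[OF assms refl refl], symmetric])

lemma ordered_basis_expand:
  assumes "ordered_basis (xs :: 'a::euclidean_space list)"
  shows "(\<Sum>i<DIM('a). representation (set xs) x (xs ! i) *\<^sub>R (xs ! i)) = x"
proof -
  have "x = (\<Sum>b\<in>set xs. representation (set xs) x b *\<^sub>R b)"
    using assms ordered_basis_span[OF assms]
    by (subst real_vector.sum_representation_eq) (auto simp: ordered_basis_def lin_indep_list_def)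
  also have "\<dots> = (\<Sum>i<DIM('a). representation (set xs) x (xs ! i) *\<^sub>R (xs ! i))"
    using assms by (subst sum_set_conv_nth) (auto simp: ordered_basis_def lin_indep_list_def)
  finally show ?thesis by simp
qed

lemma representation_ordered_basis_sum:
  assumes "ordered_basis (xs :: 'a::euclidean_space list)" and "i < DIM('a)"
  shows "representation (set xs) (\<Sum>k\<in>A. f k *\<^sub>R g k) (xs ! i)
    = (\<Sum>k\<in>A. f k * representation (set xs) (g k) (xs ! i))"
  using assms ordered_basis_span[OF assms(1)]
  by (simp add: real_vector.representation_sum real_vector.representation_scale
      ordered_basis_def lin_indep_list_def)

lemma representation_ordered_basis_nth:
  assumes "ordered_basis (xs :: 'a::euclidean_space list)" and "i < DIM('a)" "j < DIM('a)"
  shows "representation (set xs) (xs ! j) (xs ! i) = (if i = j then 1 else 0)"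
  using assms
  by (auto simp: real_vector.representation_basis ordered_basis_def lin_indep_list_def nth_eq_iff_index_eq)

text \<open>Coordinates in a basis are unique. This turns the existential quantifier in
  \<open>same_orientation\<close> into a condition on one determinant.\<close>

lemma coordinate_mat_unique:
  assumes "ordered_basis (xs :: 'a::euclidean_space list)" "M \<in> carrier_mat DIM('a) DIM('a)"
    and "\<And>j. j < DIM('a) \<Longrightarrow> ys ! j = (\<Sum>i<DIM('a). (M $$ (i, j)) *\<^sub>R (xs ! i))"
  shows "coordinate_mat xs ys = M"
proof (rule eq_matI)
  fix i j assume "i < dim_row M" "j < dim_col M"
  then have ij: "i < DIM('a)" "j < DIM('a)" using assms(2) by auto
  have "(\<Sum>k<DIM('a). M $$ (k, j) * (if i = k then 1 else 0)) = M $$ (i, j)"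
    using ij by (simp add: if_distrib cong: if_cong)
  then show "coordinate_mat xs ys $$ (i, j) = M $$ (i, j)"
    using ij assms
    by (simp add: coordinate_mat_def representation_ordered_basis_sum representation_ordered_basis_nth
        cong: sum.cong_simp)
qed (use assms(2) in \<open>auto simp: coordinate_mat_def\<close>)

lemma same_orientation_iff:
  "(xs, ys) \<in> same_orientation \<longleftrightarrow>
     ordered_basis xs \<and> ordered_basis ys \<and> Determinant.det (coordinate_mat xs ys) > 0"
proof (cases "ordered_basis xs")
  case True
  have "ys ! j = (\<Sum>i<DIM('a). (coordinate_mat xs ys $$ (i, j)) *\<^sub>R (xs ! i))" if "j < DIM('a)" for j
    using that ordered_basis_expand[OF True, of "ys ! j"] by (simp add: coordinate_mat_def cong: sum.cong_simp)
  then show ?thesis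
    using coordinate_mat_unique[OF True] unfolding same_orientation_def
    by (auto intro!: bexI[of _ "coordinate_mat xs ys"])
qed (simp add: same_orientation_def)

lemma coordinate_mat_mult:
  assumes "ordered_basis (xs :: 'a::euclidean_space list)" "ordered_basis ys"
  shows "coordinate_mat xs ys * coordinate_mat ys zs = coordinate_mat xs zs"
proof (rule eq_matI)
  fix i j assume "i < dim_row (coordinate_mat xs zs)" "j < dim_col (coordinate_mat xs zs)"
  then have ij: "i < DIM('a)" "j < DIM('a)" by (auto simp: coordinate_mat_def)
  have "representation (set xs) (zs ! j) (xs ! i)
    = representation (set xs) (\<Sum>k<DIM('a). representation (set ys) (zs ! j) (ys ! k) *\<^sub>R (ys ! k)) (xs ! i)"
    by (simp add: ordered_basis_expand[OF assms(2)])
  also have "\<dots> = (\<Sum>k<DIM('a). representation (set ys) (zs ! j) (ys ! k) * representation (set xs) (ys ! k) (xs ! i))"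
    by (rule representation_ordered_basis_sum[OF assms(1) ij(1)])
  finally show "(coordinate_mat xs ys * coordinate_mat ys zs) $$ (i, j) = coordinate_mat xs zs $$ (i, j)"
    using ij by (simp add: coordinate_mat_def scalar_prod_def atLeast0LessThan mult.commute cong: sum.cong_simp)
qed (auto simp: coordinate_mat_def)

lemma coordinate_mat_self:
  assumes "ordered_basis (xs :: 'a::euclidean_space list)"
  shows "coordinate_mat xs xs = 1\<^sub>m DIM('a)"
  by (rule eq_matI) (auto simp: coordinate_mat_def representation_ordered_basis_nth[OF assms])

lemma det_coordinate_mat_nonzero:
  assumes "ordered_basis (xs :: 'a::euclidean_space list)" "ordered_basis ys"
  shows "Determinant.det (coordinate_mat xs ys) \<noteq> 0"
proof
  assume "Determinant.det (coordinate_mat xs ys) = 0"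
  \<comment> \<open>This product is the identity matrix, by the composition law for changes of
    basis.\<close>
  then have "Determinant.det (coordinate_mat xs ys * coordinate_mat ys xs) = 0"
    by (subst Determinant.det_mult[of _ "DIM('a)"]) auto
  then show False
    using coordinate_mat_mult[OF assms, of xs] coordinate_mat_self[OF assms(1)] by simp
qed

text \<open>Negating the last vector is a change of basis by the diagonal matrix with entries 1,
  ..., 1, -1, and determinants multiply. Matrix indices start at 0, so the last one is
  \<open>DIM('a) - 1\<close>.\<close>

lemma det_coordinate_mat_uminus_last:
  fixes xs es :: "'a::euclidean_space list"
  assumes xs: "ordered_basis xs" and es: "ordered_basis (es @ [v])"
  shows "Determinant.det (coordinate_mat xs (es @ [- v])) = - Determinant.det (coordinate_mat xs (es @ [v]))"
proof -
  let ?n = "DIM('a)"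
  have len: "length es = ?n - 1" using es by (auto simp: ordered_basis_def)
  have "coordinate_mat (es @ [v]) (es @ [- v]) = multrow_mat ?n (?n - 1) (-1)"
  proof (rule coordinate_mat_unique[OF es])
    fix j assume j: "j < ?n"
    have "(\<Sum>i<?n. (multrow_mat ?n (?n - 1) (-1) $$ (i, j)) *\<^sub>R ((es @ [v]) ! i))
      = (\<Sum>i<?n. if i = j then (if j = ?n - 1 then -1 else 1) *\<^sub>R ((es @ [v]) ! j) else 0)"
      using j by (intro sum.cong) (auto simp: multrow_mat_def)
    also have "\<dots> = (es @ [- v]) ! j"
      using j len by (auto simp: nth_append)
    finally show "(es @ [- v]) ! j = (\<Sum>i<?n. (multrow_mat ?n (?n - 1) (-1) $$ (i, j)) *\<^sub>R ((es @ [v]) ! i))"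
      by simp
  qed simp
  then have "Determinant.det (coordinate_mat (es @ [v]) (es @ [- v])) = -1"
    by (simp add: det_multrow_mat)
  then show ?thesis
    using coordinate_mat_mult[OF xs es, of "es @ [- v]"]
    by (metis Determinant.det_mult coordinate_mat_carrier mult.commute mult_minus1)
qed

section \<open>Orthonormal bases and the choice of the last vector\<close>

lemma orthonormal_list_ordered_basis:
  assumes "orthonormal_list (xs :: 'a::euclidean_space list)" "length xs = DIM('a)"
  shows "ordered_basis xs"
proof -
  have d: "distinct xs"
    using assms(1) unfolding orthonormal_list_def distinct_conv_nth by (metis zero_neq_one)
  have "pairwise orthogonal (set xs)"
    using assms(1) unfolding orthonormal_list_def pairwise_def orthogonal_def
    by (metis in_set_conv_nth)
  moreover have "0 \<notin> set xs"
    using assms(1) unfolding orthonormal_list_def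
    by (metis in_set_conv_nth inner_zero_left zero_neq_one)
  ultimately show ?thesis
    using d assms(2) by (simp add: ordered_basis_def lin_indep_list_def pairwise_orthogonal_independent)
qed

lemma orthonormal_list_snoc:
  "orthonormal_list (xs @ [v]) \<longleftrightarrow>
     orthonormal_list xs \<and> (\<forall>x\<in>set xs. v \<bullet> x = 0) \<and> v \<bullet> v = 1"
  unfolding orthonormal_list_def
  by (auto simp: nth_append less_Suc_eq all_set_conv_all_nth inner_commute)

text \<open>Justifies the \<open>THE\<close> in \<open>frenet_frame\<close>. The vectors orthogonal
  to \<open>es\<close> form a line; its two unit vectors are opposite, and exactly one of them gives
  a positive determinant.\<close>

lemma ex1_positive_completion:
  fixes es :: "'a::euclidean_space list"
  assumes Or: "orientation Or" and es: "orthonormal_list es" "length es = DIM('a) - 1"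
  shows "\<exists>!v. es @ [v] \<in> Or \<and> orthonormal_list (es @ [v])"
proof -
  obtain xs where xs: "ordered_basis xs" and Or_eq: "Or = same_orientation `` {xs}"
    using Or by (auto simp: orientation_def quotient_def)
  have basis: "ordered_basis (es @ [v])" if "orthonormal_list (es @ [v])" for v
    using that es DIM_positive[where 'a='a] by (intro orthonormal_list_ordered_basis) auto
  have mem: "es @ [v] \<in> Or \<longleftrightarrow> Determinant.det (coordinate_mat xs (es @ [v])) > 0"
    if "orthonormal_list (es @ [v])" for v
    using xs basis[OF that] by (simp add: Or_eq same_orientation_iff)
  have uminus: "orthonormal_list (es @ [- v])" if "orthonormal_list (es @ [v])" for v
    using that by (simp add: orthonormal_list_snoc)
  have "card (set es) < DIM('a)"
    using es(2) DIM_positive[where 'a='a] card_length[of es] by linarith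
  then have "dim (set es) < DIM('a)"
    using dim_le_card'[of "set es"] by simp
  then obtain u where u: "u \<noteq> 0" "\<And>y. y \<in> span (set es) \<Longrightarrow> orthogonal u y"
    using orthogonal_to_subspace_exists by blast
  have on: "orthonormal_list (es @ [sgn u])"
    using es(1) u span_base[of _ "set es"]
    by (auto simp: orthonormal_list_snoc orthogonal_def sgn_div_norm dot_square_norm power2_eq_square)
  have "\<exists>v. es @ [v] \<in> Or \<and> orthonormal_list (es @ [v])"
  proof (cases "Determinant.det (coordinate_mat xs (es @ [sgn u])) > 0")
    case True
    then show ?thesis using mem on by blast
  next
    case False
    then have "Determinant.det (coordinate_mat xs (es @ [- sgn u])) > 0"
      using det_coordinate_mat_uminus_last[OF xs basis[OF on]]
        det_coordinate_mat_nonzero[OF xs basis[OF on]] by linarith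
    then show ?thesis using mem[OF uminus[OF on]] uminus[OF on] by blast
  qed
  moreover have "v = w"
    if v: "es @ [v] \<in> Or \<and> orthonormal_list (es @ [v])"
      and w: "es @ [w] \<in> Or \<and> orthonormal_list (es @ [w])" for v w
  proof -
    \<comment> \<open>The part of \<open>w\<close> perpendicular to \<open>v\<close> is orthogonal
      to every vector of the basis \<open>es @ [v]\<close>, hence to itself.\<close>
    have "w - (w \<bullet> v) *\<^sub>R v \<in> span (set (es @ [v]))"
      using ordered_basis_span[OF basis] v by simp
    then have "orthogonal (w - (w \<bullet> v) *\<^sub>R v) (w - (w \<bullet> v) *\<^sub>R v)"
      by (rule orthogonal_to_span)
        (use v w in \<open>auto simp: orthonormal_list_snoc orthogonal_def inner_diff_left inner_diff_right\<close>)
    then have eq: "w = (w \<bullet> v) *\<^sub>R v" by (simp add: orthogonal_def)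
    moreover have "norm v = 1" "norm w = 1"
      using v w by (simp_all add: orthonormal_list_snoc norm_eq_sqrt_inner)
    ultimately have "\<bar>w \<bullet> v\<bar> = 1"
      by (metis norm_scaleR mult.right_neutral)
    then have "w = v \<or> w = - v"
      using eq by (auto simp: abs_if split: if_splits)
    moreover have "es @ [- v] \<notin> Or"
      using v mem[of v] mem[OF uminus, of v] det_coordinate_mat_uminus_last[OF xs basis, of v] by simp
    ultimately show ?thesis using w by auto
  qed
  ultimately show ?thesis by blast
qed

section \<open>Curvatures of an affine image\<close>

lemma nth_derivative_0 [simp]: "nth_derivative a b c 0 = c"
  by (simp add: nth_derivative_def)

lemma nth_derivative_Suc:
  "nth_derivative a b c (Suc k) t = vector_derivative (nth_derivative a b c k) (at t within {a..b})"
  by (simp add: nth_derivative_def)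

lemma regular_curve_has_vector_derivative:
  fixes c :: "real \<Rightarrow> 'a::euclidean_space"
  assumes "regular_curve a b c" "k < DIM('a)" "t \<in> {a..b}"
  shows "(nth_derivative a b c k has_vector_derivative nth_derivative a b c (Suc k) t) (at t within {a..b})"
  using assms unfolding nth_derivative_Suc regular_curve_def differentiable_on_def
  by (simp flip: vector_derivative_works)

text \<open>The translation survives only at order 0. The bound on \<open>k\<close> is the order up
  to which regularity provides derivatives.\<close>

lemma nth_derivative_affine:
  fixes c :: "real \<Rightarrow> 'a::euclidean_space" and L :: "'a \<Rightarrow> 'b::euclidean_space"
  assumes c: "regular_curve a b c" and L: "bounded_linear L" and "k \<le> DIM('a)" "t \<in> {a..b}"
  shows "nth_derivative a b (\<lambda>t. L (c t) + w) k t
    = L (nth_derivative a b c k t) + (if k = 0 then w else 0)"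
  using assms(3,4)
proof (induction k arbitrary: t)
  case (Suc k)
  have "((\<lambda>t. L (nth_derivative a b c k t) + (if k = 0 then w else 0)) has_vector_derivative
      L (nth_derivative a b c (Suc k) t)) (at t within {a..b})"
    using Suc.prems
    by (intro has_vector_derivative_add_const[THEN iffD2] bounded_linear.has_vector_derivative[OF L]
        regular_curve_has_vector_derivative[OF c]) auto
  then have "(nth_derivative a b (\<lambda>t. L (c t) + w) k has_vector_derivative
      L (nth_derivative a b c (Suc k) t)) (at t within {a..b})"
    by (rule has_vector_derivative_transform[rotated -1]) (use Suc in auto)
  then have "vector_derivative (nth_derivative a b (\<lambda>t. L (c t) + w) k) (at t within {a..b})
      = L (nth_derivative a b c (Suc k) t)"
    \<comment> \<open>Regularity includes \<open>a < b\<close>, which makes derivatives within the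
      interval unique, also at the end points.\<close>
    using c Suc.prems by (intro vector_derivative_within_closed_interval) (auto simp: regular_curve_def)
  then show ?case
    by (simp add: nth_derivative_Suc[of _ _ "\<lambda>t. L (c t) + w"])
qed simp

lemma regular_curve_affine:
  fixes c :: "real \<Rightarrow> 'a::euclidean_space" and L :: "'a \<Rightarrow> 'a"
  assumes c: "regular_curve a b c" and L: "linear L" "inj L"
  shows "regular_curve a b (\<lambda>t. L (c t) + w)"
  unfolding regular_curve_def
proof (intro conjI allI ballI impI)
  note aff = nth_derivative_affine[OF c linear_conv_bounded_linear[THEN iffD1, OF L(1)], of _ _ w]
  show "a < b" using c by (simp add: regular_curve_def)
  show "nth_derivative a b (\<lambda>t. L (c t) + w) k differentiable_on {a..b}" if k: "k < DIM('a)" for k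
  proof -
    show ?thesis
      unfolding differentiable_on_def
    proof
      fix t assume t: "t \<in> {a..b}"
      have "nth_derivative a b c k differentiable (at t within {a..b})"
        by (rule differentiableI_vector[OF regular_curve_has_vector_derivative[OF c k t]])
      from differentiable_compose[OF linear_imp_differentiable[OF L(1)] this]
      have "(\<lambda>t. L (nth_derivative a b c k t) + (if k = 0 then w else 0)) differentiable (at t within {a..b})"
        by (rule differentiable_add) simp
      then show "nth_derivative a b (\<lambda>t. L (c t) + w) k differentiable (at t within {a..b})"
        by (rule differentiable_transform_within[where d = 1]) (use k aff t in simp_all)
    qed
  qed
  show "lin_indep_list (map (\<lambda>k. nth_derivative a b (\<lambda>t. L (c t) + w) k t) [1..<DIM('a)])"
    if t: "t \<in> {a..b}" for t
  proof -
    let ?xs = "map (\<lambda>k. nth_derivative a b c k t) [1..<DIM('a)]"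
    have "map (\<lambda>k. nth_derivative a b (\<lambda>t. L (c t) + w) k t) [1..<DIM('a)] = map L ?xs"
      using aff t by simp
    moreover have "lin_indep_list ?xs"
      using c t by (simp add: regular_curve_def)
    then have "lin_indep_list (map L ?xs)"
      unfolding lin_indep_list_def set_map distinct_map[of L]
      using L linear_independent_injective_image[OF L(1), of "set ?xs"] by (auto intro: inj_on_subset)
    ultimately show ?thesis by metis
  qed
qed

lemma gs_residual_nonzero:
  assumes "lin_indep_list (map v [1..<n])" "1 \<le> i" "i < n"
  shows "gs_residual v i \<noteq> 0"
proof
  have inj: "inj_on v {1..<n}" and ind: "independent (v ` {1..<n})"
    using assms(1) by (auto simp: lin_indep_list_def distinct_map)
  assume "gs_residual v i = 0"
  then have "v i \<in> span (v ` {1..<i})"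
    using gs_residual_diff_in_span[of v i] by simp
  \<comment> \<open>Distinctness of the family ensures that no earlier vector equals
    \<open>v i\<close>.\<close>
  moreover have "v ` {1..<i} \<subseteq> v ` {1..<n} - {v i}"
    using assms inj by (auto simp: inj_on_eq_iff)
  ultimately have "v i \<in> span (v ` {1..<n} - {v i})"
    using span_mono by blast
  then show False
    using ind assms unfolding dependent_def by auto
qed

lemma regular_curve_residual_nonzero:
  fixes c :: "real \<Rightarrow> 'a::euclidean_space"
  assumes "regular_curve a b c" "t \<in> {a..b}" "1 \<le> i" "i < DIM('a)"
  shows "gs_residual (\<lambda>k. nth_derivative a b c k t) i \<noteq> 0"
  using assms by (intro gs_residual_nonzero[where n = "DIM('a)"]) (auto simp: regular_curve_def)

section \<open>The Frenet frame and the curvature formula\<close>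

lemma frenet_frame_eq_gram_schmidt:
  fixes c :: "real \<Rightarrow> 'a::euclidean_space"
  assumes "i < DIM('a)"
  shows "frenet_frame Or a b c i t = gram_schmidt (\<lambda>k. nth_derivative a b c k t) i"
  using assms by (simp add: frenet_frame_def Let_def)

lemma frenet_frame_orthonormal:
  fixes c :: "real \<Rightarrow> 'a::euclidean_space"
  assumes Or: "orientation Or" and c: "regular_curve a b c" and t: "t \<in> {a..b}"
  shows "orthonormal_list (map (gram_schmidt (\<lambda>k. nth_derivative a b c k t)) [1..<DIM('a)]
    @ [frenet_frame Or a b c DIM('a) t])"
proof -
  let ?e = "gram_schmidt (\<lambda>k. nth_derivative a b c k t)"
  have "?e i \<bullet> ?e i = 1" if "1 \<le> i" "i < DIM('a)" for i
    using regular_curve_residual_nonzero[OF c t that]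
    by (simp add: gram_schmidt_eq norm_sgn dot_square_norm)
  then have "orthonormal_list (map ?e [1..<DIM('a)])"
    unfolding orthonormal_list_def by (auto simp: gram_schmidt_orthogonal)
  from theI'[OF ex1_positive_completion[OF Or this]] show ?thesis
    by (simp add: frenet_frame_def Let_def)
qed

text \<open>This removes from the derivative of the \<open>r\<close>-th frame vector everything but
  its component along the derivative of order \<open>Suc r\<close>. The two cases follow the two
  clauses of \<open>frenet_frame\<close>.\<close>

lemma frenet_frame_Suc_orthogonal:
  fixes c :: "real \<Rightarrow> 'a::euclidean_space"
  assumes "orientation Or" "regular_curve a b c" "t \<in> {a..b}" "r < DIM('a)"
    and y: "y \<in> span ((\<lambda>k. nth_derivative a b c k t) ` {1..<Suc r})"
  shows "frenet_frame Or a b c (Suc r) t \<bullet> y = 0"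
proof (rule orthogonal_gram_schmidt_imp_orthogonal_span[OF _ y])
  fix i assume i: "i \<in> {1..<Suc r}"
  show "frenet_frame Or a b c (Suc r) t \<bullet> gram_schmidt (\<lambda>k. nth_derivative a b c k t) i = 0"
  proof (cases "Suc r < DIM('a)")
    case True
    then show ?thesis
      using i by (simp add: frenet_frame_eq_gram_schmidt gram_schmidt_orthogonal)
  next
    case False
    then have "Suc r = DIM('a)" using assms by simp
    then show ?thesis
      using frenet_frame_orthonormal[OF assms(1-3)] i by (auto simp: orthonormal_list_snoc)
  qed
qed

text \<open>For \<open>Suc r < DIM('a)\<close> the frame vector is the normalized residual. For
  \<open>Suc r = DIM('a)\<close> it is fixed by the orientation, and the residual is a multiple of
  it with either sign or zero; hence the absolute value.\<close>

lemma frenet_frame_Suc_inner: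
  fixes c :: "real \<Rightarrow> 'a::euclidean_space"
  assumes Or: "orientation Or" and c: "regular_curve a b c" and t: "t \<in> {a..b}" and r: "r < DIM('a)"
  defines "v \<equiv> \<lambda>k. nth_derivative a b c k t"
  shows "\<bar>v (Suc r) \<bullet> frenet_frame Or a b c (Suc r) t\<bar> = norm (gs_residual v (Suc r))"
proof (cases "Suc r < DIM('a)")
  case True
  then show ?thesis
    using gs_residual_inner_gram_schmidt[of v "Suc r"]
    by (simp add: v_def frenet_frame_eq_gram_schmidt)
next
  case False
  then have n: "Suc r = DIM('a)" using r by simp
  let ?f = "frenet_frame Or a b c (Suc r) t" and ?w = "gs_residual v (Suc r)"
  let ?es = "map (gram_schmidt v) [1..<Suc r] @ [?f]"
  have on: "orthonormal_list ?es"
    using frenet_frame_orthonormal[OF Or c t] by (simp add: v_def n)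
  have "?f \<bullet> (v (Suc r) - ?w) = 0"
    using gs_residual_diff_in_span[of v "Suc r"] unfolding v_def
    by (intro frenet_frame_Suc_orthogonal[OF Or c t r]) simp
  then have vw: "v (Suc r) \<bullet> ?f = ?w \<bullet> ?f"
    by (simp add: inner_diff_right inner_commute)
  \<comment> \<open>The residual without its component along \<open>?f\<close> is orthogonal to the
    whole orthonormal basis \<open>?es\<close>, so it vanishes.\<close>
  have "?w - (?w \<bullet> ?f) *\<^sub>R ?f \<in> span (set ?es)"
    using ordered_basis_span[OF orthonormal_list_ordered_basis[OF on]] n by simp
  then have "orthogonal (?w - (?w \<bullet> ?f) *\<^sub>R ?f) (?w - (?w \<bullet> ?f) *\<^sub>R ?f)"
    by (rule orthogonal_to_span)
      (use on in \<open>auto simp: orthonormal_list_snoc orthogonal_def inner_diff_left gs_residual_orthogonal\<close>)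
  then have "?w = (?w \<bullet> ?f) *\<^sub>R ?f" by (simp add: orthogonal_def)
  then have "norm ?w = \<bar>?w \<bullet> ?f\<bar> * norm ?f" by (metis norm_scaleR)
  moreover have "norm ?f = 1"
    using on by (simp add: orthonormal_list_snoc norm_eq_sqrt_inner)
  ultimately show ?thesis using vw by simp
qed

text \<open>Modulo the span of the first \<open>r\<close> derivatives, the derivative of the
  \<open>r\<close>-th frame vector is \<open>v (Suc r)\<close> divided by the norm of the
  \<open>r\<close>-th residual, and the next frame vector is orthogonal to that span.\<close>

lemma curvature_eq:
  fixes c :: "real \<Rightarrow> 'a::euclidean_space"
  assumes Or: "orientation Or" and c: "regular_curve a b c" and t: "t \<in> {a..b}"
    and r: "1 \<le> r" "r < DIM('a)"
  defines "v \<equiv> \<lambda>k. nth_derivative a b c k t"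
  shows "curvature Or a b c r t = (v (Suc r) \<bullet> frenet_frame Or a b c (Suc r) t)
      / (norm (gs_residual v r) * norm (gs_residual v 1))"
proof -
  let ?f = "frenet_frame Or a b c (Suc r) t"
  have "\<exists>d. ((\<lambda>x. gram_schmidt (\<lambda>k. nth_derivative a b c k x) r) has_vector_derivative d) (at t within {a..b}) \<and>
    d - nth_derivative a b c (Suc r) t /\<^sub>R norm (gs_residual (\<lambda>k. nth_derivative a b c k t) r)
      \<in> span ((\<lambda>k. nth_derivative a b c k t) ` {1..<Suc r})"
    using r by (intro gram_schmidt_has_vector_derivative regular_curve_has_vector_derivative[OF c _ t]
        regular_curve_residual_nonzero[OF c t]) auto
  then obtain d where d: "(frenet_frame Or a b c r has_vector_derivative d) (at t within {a..b})"
    and ds: "d - v (Suc r) /\<^sub>R norm (gs_residual v r) \<in> span (v ` {1..<Suc r})"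
    using r ext[of "frenet_frame Or a b c r", OF frenet_frame_eq_gram_schmidt] by (auto simp: v_def)
  have "vector_derivative (frenet_frame Or a b c r) (at t within {a..b}) = d"
    using c t d by (simp add: regular_curve_def vector_derivative_within_closed_interval)
  moreover have "?f \<bullet> (d - v (Suc r) /\<^sub>R norm (gs_residual v r)) = 0"
    using ds r unfolding v_def by (intro frenet_frame_Suc_orthogonal[OF Or c t]) auto
  then have "d \<bullet> ?f = (v (Suc r) \<bullet> ?f) / norm (gs_residual v r)"
    by (simp add: inner_diff_right inner_commute divide_inverse mult.commute)
  \<comment> \<open>The sum in the first residual is empty, so the speed is itself the norm of a
    residual.\<close>
  moreover have "nth_derivative a b c 1 t = gs_residual v 1"
    by (simp add: v_def gs_residual_def)
  ultimately show ?thesis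
    by (simp add: curvature_def)
qed

lemma abs_curvature_eq:
  fixes c :: "real \<Rightarrow> 'a::euclidean_space"
  assumes "orientation Or" "regular_curve a b c" "t \<in> {a..b}" "1 \<le> r" "r < DIM('a)"
  defines "v \<equiv> \<lambda>k. nth_derivative a b c k t"
  shows "\<bar>curvature Or a b c r t\<bar> =
    norm (gs_residual v (Suc r)) / (norm (gs_residual v r) * norm (gs_residual v 1))"
  using assms frenet_frame_Suc_inner[OF assms(1-3,5)]
  by (simp add: curvature_eq abs_mult v_def)

text \<open>Here the next frame vector still comes from Gram-Schmidt, so the numerator in
  \<open>curvature_eq\<close> is the norm of a residual.\<close>

lemma curvature_nonneg:
  fixes c :: "real \<Rightarrow> 'a::euclidean_space"
  assumes "orientation Or" "regular_curve a b c" "t \<in> {a..b}" "1 \<le> r" "Suc r < DIM('a)"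
  shows "curvature Or a b c r t \<ge> 0"
  using assms gs_residual_inner_gram_schmidt[of "\<lambda>k. nth_derivative a b c k t" "Suc r"]
  by (simp add: curvature_eq frenet_frame_eq_gram_schmidt)

section \<open>Comparison of the curvatures\<close>

lemma onorm_mult_onorm_inv_ge_1:
  assumes "bounded_linear (L :: 'a::euclidean_space \<Rightarrow> 'a)" "bounded_linear M" "\<And>x. M (L x) = x"
  shows "1 \<le> onorm L * onorm M"
proof -
  obtain u :: 'a where u: "norm u = 1"
    using norm_Basis SOME_Basis by blast
  have "norm (M (L u)) \<le> onorm M * norm (L u)" by (rule onorm[OF assms(2)])
  also have "\<dots> \<le> onorm M * (onorm L * norm u)"
    by (intro mult_left_mono onorm assms onorm_pos_le)
  finally show ?thesis by (simp add: assms(3) u mult.commute)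
qed

text \<open>The exponent \<open>m\<close> is independent of \<open>r\<close> so that one estimate
  covers both claims: \<open>m = r\<close> for the lower curvatures and \<open>m = 1\<close> for the
  last.\<close>

lemma abs_curvature_affine_le:
  fixes c :: "real \<Rightarrow> 'a::euclidean_space" and L M :: "'a \<Rightarrow> 'a"
  assumes Or: "orientation Or" and c: "regular_curve a b c" and t: "t \<in> {a..b}"
    and r: "1 \<le> r" "r < DIM('a)" and m: "1 \<le> m"
    and L: "linear L" and M: "linear M" and left_inv: "\<And>x. M (L x) = x"
  shows "\<bar>curvature Or a b (\<lambda>t. L (c t) + w) r t\<bar>
    \<le> onorm L ^ (2 * m) * onorm M ^ (2 * m + 1) * \<bar>curvature Or a b c r t\<bar>"
proof -
  have L': "bounded_linear L" and M': "bounded_linear M"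
    using L M by (auto simp: linear_conv_bounded_linear)
  define A B where "A = onorm L" and "B = onorm M"
  define g where "g i = norm (gs_residual (\<lambda>k. nth_derivative a b c k t) i)" for i
  define h where "h i = norm (gs_residual (\<lambda>k. nth_derivative a b (\<lambda>t. L (c t) + w) k t) i)" for i
  have reg: "regular_curve a b (\<lambda>t. L (c t) + w)"
    using c L left_inv by (intro regular_curve_affine) (auto intro: inj_on_inverseI)
  \<comment> \<open>The derivatives of the image curve are known to be images under \<open>L\<close>
    only for orders from 1 to \<open>DIM('a)\<close>; the residual at \<open>i\<close> depends only
    on the orders 1 to \<open>i\<close>.\<close>
  have residual_cong: "gs_residual u i = gs_residual u' i"
    if "\<And>k. k \<in> {1..i} \<Longrightarrow> u k = u' k" "1 \<le> i" for u u' :: "nat \<Rightarrow> 'a" and i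
    using that
  proof (induction i rule: less_induct)
    case (less i)
    have "gram_schmidt u j = gram_schmidt u' j" if "j \<in> {1..<i}" for j
      using less that by (simp add: gram_schmidt_eq)
    then show ?case
      using less.prems by (simp add: gs_residual_def)
  qed
  have h_eq: "h i = norm (gs_residual (\<lambda>k. L (nth_derivative a b c k t)) i)"
    if "1 \<le> i" "i \<le> DIM('a)" for i
    unfolding h_def using that nth_derivative_affine[OF c L' _ t]
    by (intro arg_cong[where f = norm] residual_cong) auto
  \<comment> \<open>The second bound applies the distance estimate to \<open>M\<close> and the image
    family, which \<open>M\<close> maps back to the original one.\<close>
  have hg: "h i \<le> A * g i" and gh: "g i \<le> B * h i" if "1 \<le> i" "i \<le> DIM('a)" for i
    using norm_gs_residual_image_le[OF L', of "\<lambda>k. nth_derivative a b c k t" i]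
      norm_gs_residual_image_le[OF M', of "\<lambda>k. L (nth_derivative a b c k t)" i]
    by (simp_all add: h_eq[OF that] g_def A_def B_def left_inv)
  have pos: "0 < g r" "0 < g 1" "0 < h r" "0 < h 1"
    using regular_curve_residual_nonzero[OF c t] regular_curve_residual_nonzero[OF reg t] r
    by (auto simp: g_def h_def)
  have AB: "1 \<le> A * B" and A0: "0 \<le> A" and B0: "0 \<le> B"
    unfolding A_def B_def using onorm_mult_onorm_inv_ge_1[OF L' M' left_inv]
    by (simp_all add: onorm_pos_le L' M')
  have "h (Suc r) * (g r * g 1) \<le> (A * g (Suc r)) * ((B * h r) * (B * h 1))"
    using r pos A0 B0 by (intro mult_mono hg gh) (auto simp: g_def)
  then have "h (Suc r) / (h r * h 1) \<le> A * B ^ 2 * (g (Suc r) / (g r * g 1))"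
    using pos by (simp add: field_simps power2_eq_square)
  \<comment> \<open>The inserted factor is at least 1 and supplies exactly the powers missing for
    the exponents \<open>2 * m\<close> and \<open>2 * m + 1\<close>.\<close>
  also have "\<dots> \<le> (A * B) ^ (2 * m - 1) * (A * B ^ 2) * (g (Suc r) / (g r * g 1))"
  proof (rule mult_right_mono)
    show "A * B ^ 2 \<le> (A * B) ^ (2 * m - 1) * (A * B ^ 2)"
      using mult_right_mono[OF one_le_power[OF AB, of "2 * m - 1"], of "A * B ^ 2"] A0 B0 by simp
    show "0 \<le> g (Suc r) / (g r * g 1)" by (simp add: g_def)
  qed
  also have "(A * B) ^ (2 * m - 1) * (A * B ^ 2) = (A * B) ^ Suc (2 * m - 1) * B"
    by (simp add: power2_eq_square mult_ac)
  also have "\<dots> = A ^ (2 * m) * B ^ (2 * m + 1)"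
    using m by (simp add: power_mult_distrib power_add)
  finally show ?thesis
    using abs_curvature_eq[OF Or c t r] abs_curvature_eq[OF Or reg t r]
    by (simp add: A_def B_def g_def h_def)
qed

lemma abs_curvature_affine_ge:
  fixes c :: "real \<Rightarrow> 'a::euclidean_space" and L M :: "'a \<Rightarrow> 'a"
  assumes Or: "orientation Or" and c: "regular_curve a b c" and t: "t \<in> {a..b}"
    and r: "1 \<le> r" "r < DIM('a)" and m: "1 \<le> m"
    and L: "linear L" and M: "linear M" and left_inv: "\<And>x. M (L x) = x" and right_inv: "\<And>x. L (M x) = x"
  shows "onorm M powi (- 2 * int m) * onorm L powi (- 2 * int m - 1) * \<bar>curvature Or a b c r t\<bar>
    \<le> \<bar>curvature Or a b (\<lambda>t. L (c t) + w) r t\<bar>"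
proof -
  have reg: "regular_curve a b (\<lambda>t. L (c t) + w)"
    using c L left_inv by (intro regular_curve_affine) (auto intro: inj_on_inverseI)
  \<comment> \<open>The original curve is the affine image of the new one under \<open>M\<close>
    with translation \<open>- M w\<close>, so the upper bound applies with \<open>L\<close> and
    \<open>M\<close> exchanged.\<close>
  have "(\<lambda>t. M (L (c t) + w) + - M w) = c"
    by (simp add: linear_add[OF M] left_inv)
  then have le: "\<bar>curvature Or a b c r t\<bar>
      \<le> onorm M ^ (2 * m) * onorm L ^ (2 * m + 1) * \<bar>curvature Or a b (\<lambda>t. L (c t) + w) r t\<bar>"
    using abs_curvature_affine_le[OF Or reg t r m M L right_inv, of "- M w"] by simp
  have "1 \<le> onorm L * onorm M"
    using onorm_mult_onorm_inv_ge_1[of L M] L M left_inv by (simp add: linear_conv_bounded_linear)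
  moreover have "0 \<le> onorm L" "0 \<le> onorm M"
    using L M by (simp_all add: onorm_pos_le linear_conv_bounded_linear)
  \<comment> \<open>Both norms are nonnegative with product at least 1, so neither is zero and
    division is legitimate.\<close>
  ultimately have pos: "0 < onorm L" "0 < onorm M"
    by (auto simp: order.order_iff_strict)
  have "onorm M powi (- 2 * int m) = inverse (onorm M ^ (2 * m))"
    using power_int_minus[of "onorm M" "int (2 * m)"] unfolding power_int_of_nat by simp
  moreover have "onorm L powi (- 2 * int m - 1) = inverse (onorm L ^ (2 * m + 1))"
    using power_int_minus[of "onorm L" "int (2 * m + 1)"] unfolding power_int_of_nat by simp
  moreover have "inverse (onorm M ^ (2 * m)) * inverse (onorm L ^ (2 * m + 1)) * \<bar>curvature Or a b c r t\<bar>
      \<le> \<bar>curvature Or a b (\<lambda>t. L (c t) + w) r t\<bar>"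
    using le pos by (simp add: field_simps)
  ultimately show ?thesis by simp
qed

theorem corollary5:
  fixes Or :: "'a::euclidean_space list set"
    and c :: "real \<Rightarrow> 'a" and a b :: real
    and L :: "'a \<Rightarrow> 'a" and lam :: 'a
  defines "n \<equiv> DIM('a)"
  defines "ct \<equiv> \<lambda>t. L (c t) + lam"
  assumes "n \<ge> 2"
    and "orientation Or"
    and "regular_curve a b c"
    and "linear L" and "bij L"
  shows "(\<forall>r t. 1 \<le> r \<and> r \<le> n - 2 \<and> t \<in> {a..b} \<longrightarrow>
            onorm (Hilbert_Choice.inv L) powi (- 2 * int r) * onorm L powi (- 2 * int r - 1) * curvature Or a b c r t
              \<le> curvature Or a b ct r t \<and>
            curvature Or a b ct r t
              \<le> onorm L ^ (2 * r) * onorm (Hilbert_Choice.inv L) ^ (2 * r + 1) * curvature Or a b c r t) \<and>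
         (\<forall>t \<in> {a..b}.
            onorm (Hilbert_Choice.inv L) powi (- 2) * onorm L powi (- 3) * \<bar>curvature Or a b c (n - 1) t\<bar>
              \<le> \<bar>curvature Or a b ct (n - 1) t\<bar> \<and>
            \<bar>curvature Or a b ct (n - 1) t\<bar>
              \<le> onorm L ^ 2 * onorm (Hilbert_Choice.inv L) ^ 3 * \<bar>curvature Or a b c (n - 1) t\<bar>)"
proof -
  define M where "M = Hilbert_Choice.inv L"
  have M: "linear M" and left_inv: "\<And>x. M (L x) = x" and right_inv: "\<And>x. L (M x) = x"
    using \<open>linear L\<close> \<open>bij L\<close> unfolding M_def
    by (auto simp: bij_is_inj bij_is_surj surj_f_inv_f inj_linear_imp_inv_bounded_linear linear_conv_bounded_linear)
  note ge = abs_curvature_affine_ge[OF assms(4,5) _ _ _ _ assms(6) M left_inv right_inv, of _ _ _ lam, folded ct_def n_def]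
  note le = abs_curvature_affine_le[OF assms(4,5) _ _ _ _ assms(6) M left_inv, of _ _ _ lam, folded ct_def n_def]
  have reg: "regular_curve a b ct"
    unfolding ct_def by (rule regular_curve_affine[OF assms(5,6) bij_is_inj[OF assms(7)]])
  have nonneg: "0 \<le> curvature Or a b c r t" "0 \<le> curvature Or a b ct r t"
    if "1 \<le> r" "r \<le> n - 2" "t \<in> {a..b}" for r t
    using that curvature_nonneg[OF assms(4,5)] curvature_nonneg[OF assms(4) reg] by (auto simp: n_def)
  show ?thesis
    unfolding M_def[symmetric]
  proof (intro conjI allI impI ballI)
    \<comment> \<open>With \<open>m = r\<close> in the general estimates, nonnegativity of both
      curvatures removes the absolute values.\<close>
    fix r t assume rt: "1 \<le> r \<and> r \<le> n - 2 \<and> t \<in> {a..b}"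
    then have "r < n" by linarith
    then show "onorm M powi (- 2 * int r) * onorm L powi (- 2 * int r - 1) * curvature Or a b c r t
        \<le> curvature Or a b ct r t"
      and "curvature Or a b ct r t \<le> onorm L ^ (2 * r) * onorm M ^ (2 * r + 1) * curvature Or a b c r t"
      using ge[of t r r] le[of t r r] nonneg[of r t] rt by simp_all
  next
    \<comment> \<open>The last curvature may have either sign, so the absolute values stay;
      \<open>m = 1\<close> gives the exponents 2 and 3.\<close>
    fix t assume t: "t \<in> {a..b}"
    show "onorm M powi (- 2) * onorm L powi (- 3) * \<bar>curvature Or a b c (n - 1) t\<bar>
        \<le> \<bar>curvature Or a b ct (n - 1) t\<bar>"
      and "\<bar>curvature Or a b ct (n - 1) t\<bar>
        \<le> onorm L ^ 2 * onorm M ^ 3 * \<bar>curvature Or a b c (n - 1) t\<bar>"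
      using ge[of t "n - 1" 1] le[of t "n - 1" 1] t \<open>n \<ge> 2\<close> by (simp_all add: numeral_3_eq_3)
  qed
qed

end
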